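(* Let $\mathbf{U}$ be a finite set of players. The MPW solution $\mathrm{MPW}$ is the unique solution $\varphi$ for TUX games (with player sets $N\subseteq\mathbf{U}$) that satisfies the following two properties. (2-Standardness, 2S$^{X}$) For all $\{i,j\}\subseteq\mathbf{U}$ with $i\neq j$ and all $w\in\mathbb{W}(\{i,j\})$: $$\varphi_i(w)=w(\{i\},\{\{j\}\})+\frac{w(\{i,j\},\emptyset)-w(\{j\},\{\{i\}\})-w(\{i\},\{\{j\}\})}{2}.$$ (HM consistency, HMC$^{X}$) For all $N\subseteq\mathbf{U}$, $w\in\mathbb{W}(N)$, and $i,j\in N$ with $i\neq j$: $\varphi_i(w)=\varphi_i\big(w_{-j}^{HM,\varphi}\big)$, where $w_{-j}^{HM,\varphi}\in\mathbb{W}(N\setminus\{j\})$ is the Hart–Mas-Colell reduced game $$w_{-j}^{HM,\varphi}(S,\pi)=w(S\cup\{j\},\pi)-\varphi_j\big(w_{-N\setminus(S\cup\{j\})}\big)\quad\text{for all }(S,\pi)\in\mathcal{E}(N\setminus\{j\})\text{ with }S\neq\emptyset,$$ and $w_{-j}^{HM,\varphi}(\emptyset,\pi)=0$ for all $\pi\in\Pi(N\setminus\{j\})$.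
   Context: Let $\mathbf{U}$ be a finite set (the universe of players). Cardinalities of sets $N,S,T,B\subseteq\mathbf{U}$ are denoted $n,s,t,b$. Partitions. For $N\subseteq\mathbf{U}$, $\Pi(N)$ is the set of partitions of $N$ into non-empty blocks, with $\Pi(\emptyset)=\{\emptyset\}$. For $\pi\in\Pi(N)$ and $i\in N$, $\pi(i)$ is the block containing $i$. For $\pi\in\Pi(N)$, $i\in\mathbf{U}\setminus N$, $B\in\pi$: $\pi_{+i\rightsquigarrow B}=(\pi\setminus\{B\})\cup\{B\cup\{i\}\}$ and $\pi_{+i\rightsquigarrow\emptyset}=\pi\cup\{\{i\}\}$. TUX games. $\mathcal{E}(N)=\{(S,\pi)\mid S\subseteq N,\ \pi\in\Pi(N\setminus S)\}$ is the set of embedded coalitions. A TUX game (game with externalities) for $N\subseteq\mathbf{U}$ is a function $w:\mathcal{E}(N)\to\mathbb{R}$ with $w(\emptyset,\pi)=0$ for all $\pi\in\Pi(N)$; $\mathbb{W}(N)$ is the set of these. A solution for TUX games is a map $\varphi$ assigning to each $w\in\mathbb{W}(N)$, $N\subseteq\mathbf{U}$, a vector $\varphi(w)\in\mathbb{R}^N$. Removal of players. For $w\in\mathbb{W}(N)$ and $i\in N$, the game $w_{-i}\in\mathbb{W}(N\setminus\{i\})$ is defined by $$w_{-i}(S,\pi)=\frac{1}{n-s}\Big(w(S,\pi_{+i\rightsquigarrow\emptyset})+\sum_{j\in N\setminus(S\cup\{i\})}w(S,\pi_{+i\rightsquigarrow\pi(j)})\Big)\quad\text{for all }(S,\pi)\in\mathcal{E}(N\setminus\{i\}).$$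 This removal is path independent, i.e. $(w_{-i})_{-j}=(w_{-j})_{-i}$ for $i\neq j$, so for $T\subseteq N$ the game $w_{-T}\in\mathbb{W}(N\setminus T)$ is defined by removing the players of $T$ one after another in any order ($w_{-\emptyset}=w$). Thus $w_{-N\setminus(S\cup\{j\})}\in\mathbb{W}(S\cup\{j\})$ is $w$ with all players outside $S\cup\{j\}$ removed. MPW solution. A TU game for $N$ is a function $v:2^N\to\mathbb{R}$ with $v(\emptyset)=0$; its Shapley value is $\mathrm{Sh}_i(v)=\sum_{S\subseteq N\setminus\{i\}}\frac{s!(n-s-1)!}{n!}\left(v(S\cup\{i\})-v(S)\right)$, $i\in N$. For $w\in\mathbb{W}(N)$, the average game $\bar v_w$ is the TU game for $N$ given by $$\bar v_w(S)=\sum_{\pi\in\Pi(N\setminus S)}\frac{\prod_{B\in\pi}(b-1)!}{(n-s)!}\,w(S,\pi)\quad\text{for all }S\subseteq N,$$ and $\mathrm{MPW}(w)=\mathrm{Sh}(\bar v_w)\in\mathbb{R}^N$.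
   Formalization: The case of exactly one player in U is excluded: there both properties hold vacuously, since no two distinct players exist, so every solution satisfies them and MPW is not unique. *)

theory Defs
  imports Complex_Main "HOL-Library.FuncSet" "HOL-Library.Disjoint_Sets"
begin

type_synonym 'a embedded = "'a set \<times> 'a set set"

definition partitions :: "'a set \<Rightarrow> 'a set set set" where
  "partitions N = {\<pi>. partition_on N \<pi>}"

definition block :: "'a set set \<Rightarrow> 'a \<Rightarrow> 'a set" where
  "block \<pi> i = (THE B. B \<in> \<pi> \<and> i \<in> B)"

text \<open>The partition obtained from \<open>\<pi>\<close> when the new player \<open>i\<close> joins \<open>B\<close>. This covers both
  \<open>B \<in> \<pi>\<close> and \<open>B = {}\<close>: as the empty set is never a block, the latter adds the
  block \<open>{i}\<close> to \<open>\<pi>\<close>.\<close>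

definition join_block :: "'a set set \<Rightarrow> 'a \<Rightarrow> 'a set \<Rightarrow> 'a set set" where
  "join_block \<pi> i B = (\<pi> - {B}) \<union> {B \<union> {i}}"

definition embedded_coalitions :: "'a set \<Rightarrow> 'a embedded set" where
  "embedded_coalitions N = (SIGMA S:Pow N. partitions (N - S))"

text \<open>Games, payoff vectors and solutions are extensional functions, so that two of them are equal
  in HOL iff they agree on their domains.\<close>

definition tux_games :: "'a set \<Rightarrow> ('a embedded \<Rightarrow> real) set" where
  "tux_games N = {w \<in> embedded_coalitions N \<rightarrow>\<^sub>E UNIV. \<forall>\<pi>\<in>partitions N. w ({}, \<pi>) = 0}"

text \<open>The player set of a game is passed to a solution explicitly, since it cannot be read off
  from a HOL function.\<close>

type_synonym 'a solution = "'a set \<Rightarrow> ('a embedded \<Rightarrow> real) \<Rightarrow> 'a \<Rightarrow> real"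

definition solutions :: "'a set \<Rightarrow> 'a solution set" where
  "solutions U = (\<Pi>\<^sub>E N\<in>Pow U. tux_games N \<rightarrow>\<^sub>E (N \<rightarrow>\<^sub>E UNIV))"

definition remove_player ::
  "'a set \<Rightarrow> ('a embedded \<Rightarrow> real) \<Rightarrow> 'a \<Rightarrow> 'a embedded \<Rightarrow> real" where
  "remove_player N w i = (\<lambda>(S, \<pi>) \<in> embedded_coalitions (N - {i}).
     1 / (real (card N) - real (card S)) *
       (w (S, join_block \<pi> i {}) +
        (\<Sum>j\<in>N - (S \<union> {i}). w (S, join_block \<pi> i (block \<pi> j)))))"

primrec remove_list ::
  "'a set \<Rightarrow> ('a embedded \<Rightarrow> real) \<Rightarrow> 'a list \<Rightarrow> 'a embedded \<Rightarrow> real" where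
  "remove_list N w [] = w"
| "remove_list N w (i # is) = remove_list (N - {i}) (remove_player N w i) is"

text \<open>The players of \<open>T\<close> are removed one after another in some order; as removal is path
  independent, the choice of the order is immaterial.\<close>

definition remove_players ::
  "'a set \<Rightarrow> ('a embedded \<Rightarrow> real) \<Rightarrow> 'a set \<Rightarrow> 'a embedded \<Rightarrow> real" where
  "remove_players N w T = remove_list N w (SOME xs. distinct xs \<and> set xs = T)"

definition shapley :: "'a set \<Rightarrow> ('a set \<Rightarrow> real) \<Rightarrow> 'a \<Rightarrow> real" where
  "shapley N v = (\<lambda>i\<in>N. \<Sum>S\<in>Pow (N - {i}).
     fact (card S) * fact (card N - card S - 1) / fact (card N) * (v (S \<union> {i}) - v S))"

definition average_game :: "'a set \<Rightarrow> ('a embedded \<Rightarrow> real) \<Rightarrow> 'a set \<Rightarrow> real" where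
  "average_game N w = (\<lambda>S\<in>Pow N. \<Sum>\<pi>\<in>partitions (N - S).
     (\<Prod>B\<in>\<pi>. fact (card B - 1)) / fact (card N - card S) * w (S, \<pi>))"

definition MPW :: "'a set \<Rightarrow> 'a solution" where
  "MPW U = (\<lambda>N\<in>Pow U. \<lambda>w\<in>tux_games N. shapley N (average_game N w))"

definition two_standard :: "'a set \<Rightarrow> 'a solution \<Rightarrow> bool" where
  "two_standard U \<phi> \<longleftrightarrow>
     (\<forall>i\<in>U. \<forall>j\<in>U. i \<noteq> j \<longrightarrow> (\<forall>w\<in>tux_games {i, j}.
        \<phi> {i, j} w i = w ({i}, {{j}}) + (w ({i, j}, {}) - w ({j}, {{i}}) - w ({i}, {{j}})) / 2))"

definition hm_reduced_game ::
  "'a solution \<Rightarrow> 'a set \<Rightarrow> ('a embedded \<Rightarrow> real) \<Rightarrow> 'a \<Rightarrow> 'a embedded \<Rightarrow> real" where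
  "hm_reduced_game \<phi> N w j = (\<lambda>(S, \<pi>) \<in> embedded_coalitions (N - {j}).
     if S = {} then 0
     else w (S \<union> {j}, \<pi>) - \<phi> (S \<union> {j}) (remove_players N w (N - (S \<union> {j}))) j)"

definition hm_consistent :: "'a set \<Rightarrow> 'a solution \<Rightarrow> bool" where
  "hm_consistent U \<phi> \<longleftrightarrow>
     (\<forall>N\<in>Pow U. \<forall>w\<in>tux_games N. \<forall>i\<in>N. \<forall>j\<in>N. i \<noteq> j \<longrightarrow>
        \<phi> N w i = \<phi> (N - {j}) (hm_reduced_game \<phi> N w j) i)"

end

theory Submission
  imports Defs
begin

text \<open>
  The weights \<open>\<Prod>B\<in>\<pi>. (b - 1)!\<close> of the average game are those of the Chinese restaurant process:
  a new player joins a block \<open>B\<close> with weight \<open>b\<close> and opens a new block with weight \<open>1\<close>. Removing a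
  player from a TUX game is therefore the same as restricting its average game, and HM consistency
  of MPW reduces to HM consistency of the Shapley value for TU games. The latter follows from the
  Hart--Mas-Colell potential \<open>P\<close>: up to a constant, \<open>S \<mapsto> P (S \<union> {j})\<close> is the potential of
  the reduced game.

  For uniqueness, one-player games are embedded as reduced games of two-player games. If \<open>\<phi>\<close> agrees
  with MPW for fewer than \<open>n \<ge> 3\<close> players, the two reduced games differ only at the grand coalition,
  so the errors \<open>x\<^sub>i = \<phi>\<^sub>i(w) - MPW\<^sub>i(w)\<close> satisfy \<open>x\<^sub>i = - x\<^sub>j / (n - 1)\<close> for all \<open>i \<noteq> j\<close>, which forces
  them to vanish.
\<close>

section \<open>Adding a player to a partition\<close>

lemma finite_partitions: "finite N \<Longrightarrow> finite (partitions N)"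
  unfolding partitions_def by (rule finitely_many_partition_on)

lemma partitions_empty [simp]: "partitions {} = {{}}"
  by (simp add: partitions_def partition_on_empty)

lemma partitions_singleton [simp]: "partitions {i} = {{{i}}}"
proof -
  have "P = {{i}}" if P: "partition_on {i} P" for P
  proof -
    have U: "\<Union>P = {i}" and e: "{} \<notin> P"
      using P by (auto simp: partition_on_def)
    then have "P \<subseteq> {{i}}"
      by (metis Sup_upper singletonI subsetI subset_singletonD)
    moreover have "P \<noteq> {}"
      using U by auto
    ultimately show ?thesis by blast
  qed
  moreover have "partition_on {i} {{i}}"
    by (auto simp: partition_on_def disjoint_def)
  ultimately show ?thesis
    unfolding partitions_def by blast
qed

lemma partitions_finite: "finite N \<Longrightarrow> \<pi> \<in> partitions N \<Longrightarrow> finite \<pi>"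
  unfolding partitions_def by (auto intro: finite_elements)

lemma partitions_blockD:
  assumes "\<pi> \<in> partitions N" and "B \<in> \<pi>"
  shows "B \<subseteq> N" and "B \<noteq> {}"
  using assms by (auto simp: partitions_def partition_on_def)

lemma block_eqI:
  assumes "\<pi> \<in> partitions N" and "B \<in> \<pi>" and "j \<in> B"
  shows "block \<pi> j = B"
  unfolding block_def
proof (rule the_equality)
  show "B' = B" if "B' \<in> \<pi> \<and> j \<in> B'" for B'
    using assms that by (auto simp: partitions_def partition_on_def disjoint_def)
qed (use assms in auto)

lemma block_in_partition:
  assumes "\<pi> \<in> partitions N" and "j \<in> N"
  shows "block \<pi> j \<in> \<pi>" and "j \<in> block \<pi> j"
proof -
  obtain B where "B \<in> \<pi>" "j \<in> B"
    using assms by (auto simp: partitions_def partition_on_def)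
  then show "block \<pi> j \<in> \<pi>" "j \<in> block \<pi> j"
    using block_eqI[OF assms(1)] by auto
qed

lemma join_block_partition:
  assumes "\<pi> \<in> partitions M" and "i \<notin> M" and "B \<in> insert {} \<pi>"
  shows "join_block \<pi> i B \<in> partitions (insert i M)"
proof -
  have U: "\<Union>\<pi> = M" and d: "\<And>A C. A \<in> \<pi> \<Longrightarrow> C \<in> \<pi> \<Longrightarrow> A \<noteq> C \<Longrightarrow> A \<inter> C = {}" and e: "{} \<notin> \<pi>"
    using assms(1) by (auto simp: partitions_def partition_on_def disjoint_def)
  have i: "i \<notin> A" if "A \<in> \<pi>" for A
    using U assms(2) that by auto
  have "\<Union>(join_block \<pi> i B) = insert i M"
    using U assms(3) unfolding join_block_def by blast
  moreover have "A \<inter> C = {}" if "A \<in> join_block \<pi> i B" "C \<in> join_block \<pi> i B" "A \<noteq> C" for A C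
    using that d[of A C] d[of A B] d[of B C] i assms(3) unfolding join_block_def by auto
  moreover have "{} \<notin> join_block \<pi> i B"
    using e unfolding join_block_def by auto
  ultimately show ?thesis
    by (auto simp: partitions_def partition_on_def disjoint_def)
qed

text \<open>Deleting \<open>i\<close> from a partition of \<open>insert i M\<close> recovers the
  pair: what is left of the block of \<open>i\<close> is \<open>B\<close>, and it is empty exactly
  when \<open>i\<close> was alone. Hence \<open>{}\<close> is a legal second component, and the
  inverse map drops it from the image.\<close>

lemma bij_betw_join_block:
  assumes i: "i \<notin> M"
  shows "bij_betw (\<lambda>(\<pi>, B). join_block \<pi> i B) (SIGMA \<pi>:partitions M. insert {} \<pi>)
    (partitions (insert i M))"
proof (rule bij_betw_byWitness
    [where f' = "\<lambda>\<rho>. ((\<lambda>B. B - {i}) ` \<rho> - {{}}, block \<rho> i - {i})"])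
  have "(\<lambda>A. A - {i}) ` join_block \<pi> i B - {{}} = \<pi> \<and> block (join_block \<pi> i B) i - {i} = B"
    if \<pi>: "\<pi> \<in> partitions M" and B: "B \<in> insert {} \<pi>" for \<pi> B
  proof
    have ni: "A - {i} = A" if "A \<in> insert {} \<pi>" for A
      using partitions_blockD(1)[OF \<pi>] that i by auto
    have e: "{} \<notin> \<pi>"
      using partitions_blockD(2)[OF \<pi>] by auto
    have "(\<lambda>A. A - {i}) ` join_block \<pi> i B = (\<lambda>A. A - {i}) ` (\<pi> - {B}) \<union> {B - {i}}"
      by (auto simp: join_block_def)
    also have "\<dots> = (\<pi> - {B}) \<union> {B}"
      using ni[OF B] ni by (auto simp: image_iff)
    finally show "(\<lambda>A. A - {i}) ` join_block \<pi> i B - {{}} = \<pi>"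
      using B e by auto
    have "block (join_block \<pi> i B) i = B \<union> {i}"
      using join_block_partition[OF \<pi> i B] by (rule block_eqI) (auto simp: join_block_def)
    then show "block (join_block \<pi> i B) i - {i} = B"
      using ni[OF B] by auto
  qed
  then show "\<forall>a\<in>SIGMA \<pi>:partitions M. insert {} \<pi>. ((\<lambda>B. B - {i}) ` (case a of (\<pi>, B) \<Rightarrow> join_block \<pi> i B) - {{}},
      block (case a of (\<pi>, B) \<Rightarrow> join_block \<pi> i B) i - {i}) = a"
    by auto
  show "(\<lambda>(\<pi>, B). join_block \<pi> i B) ` (SIGMA \<pi>:partitions M. insert {} \<pi>) \<subseteq> partitions (insert i M)"
    using join_block_partition[OF _ i] by auto
  have *: "(\<lambda>B. B - {i}) ` \<rho> - {{}} \<in> partitions M \<and>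
      block \<rho> i - {i} \<in> insert {} ((\<lambda>B. B - {i}) ` \<rho> - {{}}) \<and>
      join_block ((\<lambda>B. B - {i}) ` \<rho> - {{}}) i (block \<rho> i - {i}) = \<rho>"
    if \<rho>: "\<rho> \<in> partitions (insert i M)" for \<rho>
  proof (intro conjI)
    define D where "D = block \<rho> i"
    have D: "D \<in> \<rho>" "i \<in> D"
      using block_in_partition[OF \<rho>, of i] by (auto simp: D_def)
    have U: "\<Union>\<rho> = insert i M" and e: "{} \<notin> \<rho>"
      and d: "\<And>A C. A \<in> \<rho> \<Longrightarrow> C \<in> \<rho> \<Longrightarrow> A \<noteq> C \<Longrightarrow> A \<inter> C = {}"
      using \<rho> by (auto simp: partitions_def partition_on_def disjoint_def)
    have ni: "A - {i} = A" if "A \<in> \<rho> - {D}" for A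
      using d[of A D] D that by auto
    have "(\<lambda>B. B - {i}) ` \<rho> = (\<lambda>B. B - {i}) ` (\<rho> - {D}) \<union> {D - {i}}"
      using D by auto
    also have "(\<lambda>B. B - {i}) ` (\<rho> - {D}) = \<rho> - {D}"
      using ni by (auto simp: image_iff)
    finally have im: "(\<lambda>B. B - {i}) ` \<rho> = (\<rho> - {D}) \<union> {D - {i}}" .
    have "\<Union>(F - {{}}) = \<Union>F" for F :: "'a set set"
      by blast
    then have "\<Union>((\<lambda>B. B - {i}) ` \<rho> - {{}}) = (\<Union>B\<in>\<rho>. B - {i})"
      by simp
    also have "\<dots> = \<Union>\<rho> - {i}"
      by blast
    also have "\<dots> = M"
      unfolding U using i by simp
    finally have "\<Union>((\<lambda>B. B - {i}) ` \<rho> - {{}}) = M" .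
    moreover have "A \<inter> C = {}"
      if AC: "A \<in> (\<lambda>B. B - {i}) ` \<rho>" "C \<in> (\<lambda>B. B - {i}) ` \<rho>" "A \<noteq> C" for A C
    proof -
      obtain A' C' where "A = A' - {i}" "C = C' - {i}" "A' \<in> \<rho>" "C' \<in> \<rho>"
        using AC(1,2) by blast
      then show ?thesis
        using d[of A' C'] AC(3) by blast
    qed
    ultimately show "(\<lambda>B. B - {i}) ` \<rho> - {{}} \<in> partitions M"
      unfolding partitions_def by (intro CollectI partition_onI) (simp_all add: disjnt_def)
    show "block \<rho> i - {i} \<in> insert {} ((\<lambda>B. B - {i}) ` \<rho> - {{}})"
      using im by (auto simp: D_def)
    \<comment> \<open>\<open>join_block\<close> deletes its third argument from the partition, so
      \<open>D - {i}\<close> must not coincide with a genuine block of \<rho>. If it did, it would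
      be disjoint from \<open>D\<close>, hence empty, but no block is empty.\<close>
    have "D - {i} \<notin> \<rho>"
    proof
      assume D': "D - {i} \<in> \<rho>"
      have "D \<inter> (D - {i}) = {}"
        using D by (intro d[OF D(1) D']) auto
      then have "D - {i} = {}"
        by blast
      then show False
        using D' e by metis
    qed
    then have "join_block ((\<lambda>B. B - {i}) ` \<rho> - {{}}) i (D - {i}) = (\<rho> - {D}) \<union> {D}"
      using e D unfolding im join_block_def by auto
    then show "join_block ((\<lambda>B. B - {i}) ` \<rho> - {{}}) i (block \<rho> i - {i}) = \<rho>"
      using D by (auto simp: D_def)
  qed
  then show "\<forall>\<rho>\<in>partitions (insert i M).
      (case ((\<lambda>B. B - {i}) ` \<rho> - {{}}, block \<rho> i - {i}) of (\<pi>, B) \<Rightarrow> join_block \<pi> i B) = \<rho>"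
    by auto
  show "(\<lambda>\<rho>. ((\<lambda>B. B - {i}) ` \<rho> - {{}}, block \<rho> i - {i})) ` partitions (insert i M)
      \<subseteq> (SIGMA \<pi>:partitions M. insert {} \<pi>)"
    using * by (intro image_subsetI SigmaI) auto
qed

text \<open>The bijection turned into a recursion for sums. The term for \<open>{}\<close> splits
  off because \<open>{}\<close> is never a block.\<close>

lemma sum_partitions_insert:
  fixes f :: "'a set set \<Rightarrow> 'b::comm_monoid_add"
  assumes "finite M" and "i \<notin> M"
  shows "(\<Sum>\<rho>\<in>partitions (insert i M). f \<rho>) =
    (\<Sum>\<pi>\<in>partitions M. f (join_block \<pi> i {}) + (\<Sum>B\<in>\<pi>. f (join_block \<pi> i B)))"
proof -
  have "(\<Sum>\<rho>\<in>partitions (insert i M). f \<rho>) =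
      (\<Sum>(\<pi>, B)\<in>(SIGMA \<pi>:partitions M. insert {} \<pi>). f (join_block \<pi> i B))"
    using sum.reindex_bij_betw[OF bij_betw_join_block[OF assms(2)], of f]
    by (simp add: case_prod_unfold)
  also have "\<dots> = (\<Sum>\<pi>\<in>partitions M. \<Sum>B\<in>insert {} \<pi>. f (join_block \<pi> i B))"
    using finite_partitions[OF assms(1)] partitions_finite[OF assms(1)]
    by (subst sum.Sigma) auto
  also have "\<dots> = (\<Sum>\<pi>\<in>partitions M. f (join_block \<pi> i {}) + (\<Sum>B\<in>\<pi>. f (join_block \<pi> i B)))"
  proof (rule sum.cong[OF refl])
    fix \<pi> assume "\<pi> \<in> partitions M"
    then have "finite \<pi>" "{} \<notin> \<pi>"
      using partitions_finite[OF assms(1)] partitions_blockD(2) by auto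
    then show "(\<Sum>B\<in>insert {} \<pi>. f (join_block \<pi> i B)) =
        f (join_block \<pi> i {}) + (\<Sum>B\<in>\<pi>. f (join_block \<pi> i B))"
      by simp
  qed
  finally show ?thesis .
qed

section \<open>Weighted sums over partitions\<close>

lemma sum_over_blocks:
  fixes g :: "'a set \<Rightarrow> real"
  assumes "finite M" and \<pi>: "\<pi> \<in> partitions M"
  shows "(\<Sum>j\<in>M. g (block \<pi> j)) = (\<Sum>B\<in>\<pi>. real (card B) * g B)"
proof -
  have U: "\<Union>\<pi> = M" and d: "\<forall>A\<in>\<pi>. \<forall>C\<in>\<pi>. A \<noteq> C \<longrightarrow> A \<inter> C = {}"
    using \<pi> by (auto simp: partitions_def partition_on_def disjoint_def)
  have "\<forall>A\<in>\<pi>. finite A"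
    using partitions_blockD(1)[OF \<pi>] assms(1) by (auto intro: finite_subset)
  then have "(\<Sum>j\<in>\<Union>\<pi>. g (block \<pi> j)) = (\<Sum>B\<in>\<pi>. \<Sum>j\<in>B. g (block \<pi> j))"
    using d by (subst sum.Union_disjoint) auto
  also have "\<dots> = (\<Sum>B\<in>\<pi>. real (card B) * g B)"
    using block_eqI[OF \<pi>] by (intro sum.cong) auto
  finally show ?thesis
    using U by simp
qed

text \<open>The number of permutations whose cycles are supported exactly on the blocks of \<pi>: a
  block of size b carries (b - 1)! cyclic orders.\<close>

definition weight :: "'a set set \<Rightarrow> real" where
  "weight \<pi> = (\<Prod>B\<in>\<pi>. fact (card B - 1))"

lemma weight_join_empty:
  assumes "finite M" "\<pi> \<in> partitions M" "i \<notin> M"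
  shows "weight (join_block \<pi> i {}) = weight \<pi>"
proof -
  have "{} \<notin> \<pi>" "{i} \<notin> \<pi>" "finite \<pi>"
    using partitions_blockD[OF assms(2)] assms partitions_finite by blast+
  then show ?thesis
    by (simp add: weight_def join_block_def)
qed

text \<open>Only the factor of \<open>B\<close> changes, from (b - 1)! to b!. As \<open>i\<close> is
  new, the enlarged block cannot collapse with another one in the product.\<close>

lemma weight_join_block:
  assumes M: "finite M" and \<pi>: "\<pi> \<in> partitions M" and i: "i \<notin> M" and B: "B \<in> \<pi>"
  shows "weight (join_block \<pi> i B) = real (card B) * weight \<pi>"
proof -
  have fin: "finite \<pi>" "finite B" and BM: "B \<subseteq> M" "B \<noteq> {}"
    using partitions_blockD[OF \<pi> B] partitions_finite[OF M \<pi>] M by (auto intro: finite_subset)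
  have "insert i B \<notin> \<pi>"
    using partitions_blockD(1)[OF \<pi>] i by auto
  moreover have "i \<notin> B"
    using BM i by auto
  ultimately have "weight (join_block \<pi> i B) = fact (card B) * (\<Prod>A\<in>\<pi> - {B}. fact (card A - 1))"
    using fin by (simp add: weight_def join_block_def)
  moreover have "weight \<pi> = fact (card B - 1) * (\<Prod>A\<in>\<pi> - {B}. fact (card A - 1))"
    unfolding weight_def using fin B by (simp add: prod.remove)
  moreover have "(fact (card B) :: real) = real (card B) * fact (card B - 1)"
    using fin BM by (subst fact_reduce) (auto simp: card_gt_0_iff)
  ultimately show ?thesis by simp
qed

text \<open>Joining \<open>B\<close> multiplies the weight by its size, which
  \<open>sum_over_blocks\<close> reads as one copy of the term per member of \<open>B\<close>. The
  bracket thus takes the form used in \<open>remove_player\<close>, which sums over players rather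
  than blocks.\<close>

lemma weighted_sum_partitions_insert:
  fixes f :: "'a set set \<Rightarrow> real"
  assumes "finite M" and "i \<notin> M"
  shows "(\<Sum>\<rho>\<in>partitions (insert i M). weight \<rho> * f \<rho>) =
    (\<Sum>\<pi>\<in>partitions M. weight \<pi> *
      (f (join_block \<pi> i {}) + (\<Sum>j\<in>M. f (join_block \<pi> i (block \<pi> j)))))"
  unfolding sum_partitions_insert[OF assms]
proof (rule sum.cong[OF refl])
  fix \<pi> assume \<pi>: "\<pi> \<in> partitions M"
  have "(\<Sum>B\<in>\<pi>. weight (join_block \<pi> i B) * f (join_block \<pi> i B)) =
      weight \<pi> * (\<Sum>B\<in>\<pi>. real (card B) * f (join_block \<pi> i B))"
    unfolding sum_distrib_left using weight_join_block[OF assms(1) \<pi> assms(2)]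
    by (intro sum.cong) auto
  then show "weight (join_block \<pi> i {}) * f (join_block \<pi> i {}) +
      (\<Sum>B\<in>\<pi>. weight (join_block \<pi> i B) * f (join_block \<pi> i B)) =
    weight \<pi> * (f (join_block \<pi> i {}) + (\<Sum>j\<in>M. f (join_block \<pi> i (block \<pi> j))))"
    using sum_over_blocks[OF assms(1) \<pi>, of "\<lambda>B. f (join_block \<pi> i B)"]
    by (simp add: weight_join_empty[OF assms(1) \<pi> assms(2)] distrib_left)
qed

text \<open>For a constant summand the recursion contributes a factor \<open>1 + card M\<close> per
  new player. Consequently the coefficients in the average game add up to 1.\<close>

lemma sum_weight:
  "finite M \<Longrightarrow> (\<Sum>\<pi>\<in>partitions M. weight \<pi>) = fact (card M)"
proof (induction M rule: finite_induct)
  case empty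
  show ?case by (simp add: weight_def)
next
  case (insert i M)
  have "(\<Sum>\<rho>\<in>partitions (insert i M). weight \<rho>) =
      (\<Sum>\<pi>\<in>partitions M. weight \<pi> * (1 + real (card M)))"
    using weighted_sum_partitions_insert[OF insert.hyps, of "\<lambda>_. 1"] by simp
  also have "\<dots> = fact (card (insert i M))"
    using insert by (simp flip: sum_distrib_right)
  finally show ?case .
qed

section \<open>Removing players and the average game\<close>

lemma average_game_weight:
  "S \<subseteq> N \<Longrightarrow> average_game N w S =
    (\<Sum>\<pi>\<in>partitions (N - S). weight \<pi> * w (S, \<pi>)) / fact (card N - card S)"
  by (simp add: average_game_def weight_def sum_divide_distrib)

lemma average_game_empty: "w \<in> tux_games N \<Longrightarrow> average_game N w {} = 0"
  by (simp add: average_game_weight) (simp add: tux_games_def)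

text \<open>The weighted recursion absorbs the bracket of \<open>remove_player\<close>, and its
  factor 1 / (n - s) turns the denominator (n - 1 - s)! into (n - s)!.\<close>

lemma average_game_remove_player:
  assumes N: "finite N" "i \<in> N" and S: "S \<subseteq> N - {i}"
  shows "average_game (N - {i}) (remove_player N w i) S = average_game N w S"
proof -
  define M where "M = N - {i} - S"
  have M: "finite M" "i \<notin> M" "N - S = insert i M" "N - (S \<union> {i}) = M"
    using N S by (auto simp: M_def)
  \<comment> \<open>As \<open>i\<close> lies outside \<open>S\<close>, n - s is at least 1: the
    natural subtractions are not truncated, and (n - s)! splits off the factor n - s.\<close>
  have card: "card N - card S = Suc (card (N - {i}) - card S)" "card S < card N"
  proof -
    have "card S \<le> card (N - {i})"
      using N S by (intro card_mono) auto
    moreover have "card N = Suc (card (N - {i}))"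
      using N by (metis card_Suc_Diff1)
    ultimately show "card N - card S = Suc (card (N - {i}) - card S)" "card S < card N"
      by auto
  qed
  have real_card: "real (card N) - real (card S) = real (card N - card S)"
    using card by simp
  have "(\<Sum>\<pi>\<in>partitions M. weight \<pi> * remove_player N w i (S, \<pi>)) =
      (\<Sum>\<pi>\<in>partitions M. weight \<pi> * (w (S, join_block \<pi> i {}) +
        (\<Sum>j\<in>M. w (S, join_block \<pi> i (block \<pi> j))))) / real (card N - card S)"
    unfolding sum_divide_distrib using S M(4)
    by (intro sum.cong refl)
      (auto simp: remove_player_def embedded_coalitions_def real_card simp flip: M_def)
  also have "\<dots> = (\<Sum>\<rho>\<in>partitions (N - S). weight \<rho> * w (S, \<rho>)) / real (card N - card S)"
    unfolding M(3) weighted_sum_partitions_insert[OF M(1,2), of "\<lambda>\<rho>. w (S, \<rho>)"] ..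
  finally show ?thesis
    using S by (simp add: average_game_weight M_def[symmetric] card(1) subset_Diff_insert
        Diff_subset[THEN subset_trans[OF S]] mult.commute)
qed

lemma remove_player_tux_games:
  assumes w: "w \<in> tux_games N" and i: "i \<in> N"
  shows "remove_player N w i \<in> tux_games (N - {i})"
proof -
  have "remove_player N w i ({}, \<pi>) = 0" if \<pi>: "\<pi> \<in> partitions (N - {i})" for \<pi>
  proof -
    have "w ({}, join_block \<pi> i B) = 0" if "B \<in> insert {} \<pi>" for B
    proof -
      have "join_block \<pi> i B \<in> partitions N"
        using join_block_partition[OF \<pi> _ that, of i] insert_Diff[OF i] by simp
      then show ?thesis
        using w by (simp add: tux_games_def)
    qed
    then show ?thesis
      using block_in_partition(1)[OF \<pi>] \<pi>
      by (simp add: remove_player_def embedded_coalitions_def)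
  qed
  moreover have "remove_player N w i \<in> embedded_coalitions (N - {i}) \<rightarrow>\<^sub>E UNIV"
    by (auto simp: remove_player_def)
  ultimately show ?thesis
    by (simp add: tux_games_def)
qed

section \<open>Removing several players\<close>

lemma remove_list_tux_games:
  "w \<in> tux_games N \<Longrightarrow> distinct xs \<Longrightarrow> set xs \<subseteq> N \<Longrightarrow>
    remove_list N w xs \<in> tux_games (N - set xs)"
proof (induction xs arbitrary: N w)
  case (Cons i xs)
  then have "remove_list (N - {i}) (remove_player N w i) xs \<in> tux_games (N - {i} - set xs)"
    by (intro Cons.IH remove_player_tux_games) auto
  then show ?case
    by (simp flip: Diff_insert2)
qed simp

lemma average_game_remove_list:
  "finite N \<Longrightarrow> distinct xs \<Longrightarrow> set xs \<subseteq> N \<Longrightarrow> S \<subseteq> N - set xs \<Longrightarrow>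
    average_game (N - set xs) (remove_list N w xs) S = average_game N w S"
proof (induction xs arbitrary: N w)
  case (Cons i xs)
  have "average_game (N - {i} - set xs) (remove_list (N - {i}) (remove_player N w i) xs) S =
      average_game (N - {i}) (remove_player N w i) S"
    using Cons.prems by (intro Cons.IH) auto
  also have "\<dots> = average_game N w S"
    using Cons.prems by (intro average_game_remove_player) auto
  finally show ?case
    by (simp flip: Diff_insert2)
qed simp

text \<open>Exposes the chosen enumeration of \<open>T\<close>, so that facts proved for every
  repetition-free list carry over to \<open>remove_players\<close>.\<close>

lemma remove_players_list:
  assumes "finite T"
  obtains xs where "distinct xs" "set xs = T" "remove_players N w T = remove_list N w xs"
proof -
  have "\<exists>xs. distinct xs \<and> set xs = T"
    using finite_distinct_list[OF assms] by auto
  from someI_ex[OF this] show ?thesis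
    using that remove_players_def by metis
qed

lemma remove_players_empty [simp]: "remove_players N w {} = w"
  by (rule remove_players_list[of "{}"]) auto

lemma remove_players_tux_games:
  assumes "finite T" "T \<subseteq> N" "w \<in> tux_games N"
  shows "remove_players N w T \<in> tux_games (N - T)"
  using assms by (metis remove_list_tux_games remove_players_list)

lemma average_game_remove_players:
  assumes "finite N" "T \<subseteq> N" "S \<subseteq> N - T"
  shows "average_game (N - T) (remove_players N w T) S = average_game N w S"
  using assms by (metis average_game_remove_list finite_subset remove_players_list)

section \<open>The potential of a TU game\<close>

text \<open>The Hart--Mas-Colell potential in closed form. At \<open>S = {}\<close> the truncated
  \<open>card S - 1\<close> is 0 and the coefficient is 1; the term vanishes for a TU game, where
  \<open>v {} = 0\<close>.\<close>

definition potential :: "('a set \<Rightarrow> real) \<Rightarrow> 'a set \<Rightarrow> real" where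
  "potential v N =
    (\<Sum>S\<in>Pow N. fact (card S - 1) * fact (card N - card S) / fact (card N) * v S)"

lemma shapley_cong:
  assumes "\<And>S. S \<subseteq> N \<Longrightarrow> v S = v' S"
  shows "shapley N v = shapley N v'"
  unfolding shapley_def
proof (intro restrict_ext sum.cong refl)
  fix i S assume "i \<in> N" "S \<in> Pow (N - {i})"
  then have "v S = v' S" "v (S \<union> {i}) = v' (S \<union> {i})"
    by (auto intro!: assms)
  then show "fact (card S) * fact (card N - card S - 1) / fact (card N) * (v (S \<union> {i}) - v S)
      = fact (card S) * fact (card N - card S - 1) / fact (card N) * (v' (S \<union> {i}) - v' S)"
    by simp
qed

text \<open>Split the coalitions by membership of \<open>i\<close>. Those containing
  \<open>i\<close> already carry the Shapley coefficient; for a nonempty \<open>S\<close> without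
  \<open>i\<close>, the two potentials combine to (s-1)!(n-s)!/n! - (s-1)!(n-1-s)!/(n-1)! = -
  s!(n-s-1)!/n!.\<close>

lemma shapley_eq_potential_diff:
  assumes N: "finite N" "i \<in> N" and v: "v {} = 0"
  shows "shapley N v i = potential v N - potential v (N - {i})"
proof -
  define n where "n = card N"
  define M where "M = N - {i}"
  have M: "finite M" "i \<notin> M" "N = insert i M"
    using N by (auto simp: M_def)
  have n: "n = Suc (card M)"
    using M by (simp add: n_def)
  let ?c = "\<lambda>S. fact (card S - 1) * fact (n - card S) / fact n * v S"
  have "Pow N = Pow M \<union> insert i ` Pow M"
    using M by (simp add: Pow_insert)
  moreover have "Pow M \<inter> insert i ` Pow M = {}" "inj_on (insert i) (Pow M)"
    using M by (auto simp: inj_on_def)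
  ultimately have "potential v N = (\<Sum>S\<in>Pow M. ?c S) + (\<Sum>S\<in>Pow M. ?c (insert i S))"
    using M(1) unfolding potential_def n_def[symmetric]
    by (simp add: sum.union_disjoint sum.reindex)
  also have "(\<Sum>S\<in>Pow M. ?c (insert i S)) =
      (\<Sum>S\<in>Pow M. fact (card S) * fact (n - card S - 1) / fact n * v (insert i S))"
  proof (intro sum.cong refl)
    fix S assume "S \<in> Pow M"
    then have "finite S" "i \<notin> S"
      using M finite_subset by auto
    then show "?c (insert i S) = fact (card S) * fact (n - card S - 1) / fact n * v (insert i S)"
      by simp
  qed
  finally have "potential v N - potential v M =
      (\<Sum>S\<in>Pow M. ?c S + fact (card S) * fact (n - card S - 1) / fact n * v (insert i S)
        - fact (card S - 1) * fact (card M - card S) / fact (card M) * v S)"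
    by (simp add: potential_def sum.distrib sum_subtractf)
  also have "\<dots> = (\<Sum>S\<in>Pow M. fact (card S) * fact (n - card S - 1) / fact n * (v (insert i S) - v S))"
  proof (intro sum.cong refl)
    fix S assume S: "S \<in> Pow M"
    show "?c S + fact (card S) * fact (n - card S - 1) / fact n * v (insert i S)
        - fact (card S - 1) * fact (card M - card S) / fact (card M) * v S
      = fact (card S) * fact (n - card S - 1) / fact n * (v (insert i S) - v S)"
    proof (cases "S = {}")
      case False
      have "finite S"
        using S M finite_subset by auto
      \<comment> \<open>Here \<open>s\<close> is one less than the size of \<open>S\<close>.
        Together with \<open>card M = Suc s + d\<close> this removes every truncated subtraction and
        leaves a pure factorial identity.\<close>
      with False obtain s where s: "card S = Suc s"
        by (metis card_eq_0_iff not0_implies_Suc)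
      have "card S \<le> card M"
        using S M by (intro card_mono) auto
      then obtain d where d: "card M = Suc s + d"
        using s le_Suc_ex by metis
      have "fact s * fact (Suc d) / fact (Suc (Suc s + d)) - fact s * fact d / (fact (Suc s + d) :: real)
          = - (fact (Suc s) * fact d / fact (Suc (Suc s + d)))"
        by (simp add: divide_simps) (simp add: algebra_simps)
      then have "(fact s * fact (Suc d) / fact (Suc (Suc s + d)) - fact s * fact d / (fact (Suc s + d) :: real)) * v S
          = - (fact (Suc s) * fact d / fact (Suc (Suc s + d))) * v S"
        by simp
      moreover have "Suc s + d - Suc s = d" "Suc (Suc s + d) - Suc s = Suc d"
        "Suc (Suc s + d) - Suc s - 1 = d"
        by auto
      ultimately show ?thesis
        unfolding n s d by (simp only: diff_Suc_1 right_diff_distrib left_diff_distrib)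
    qed (simp add: v)
  qed
  also have "\<dots> = shapley N v i"
    using N by (simp add: shapley_def M_def n_def)
  finally show ?thesis
    by (simp add: M_def)
qed

text \<open>Efficiency by double counting: a coalition \<open>S\<close> occurs in the potentials of
  \<open>N - {i}\<close> for n - s players \<open>i\<close>. Since (n - s)(n - 1 - s)! = (n - s)!,
  all terms with S \<noteq> N cancel against n times the potential of \<open>N\<close>, and only
  \<open>v N\<close> survives.\<close>

lemma sum_potential_diff:
  assumes N: "finite N" and v: "v {} = 0"
  shows "(\<Sum>i\<in>N. potential v N - potential v (N - {i})) = v N"
proof (cases "N = {}")
  case False
  define n where "n = card N"
  have n: "n > 0"
    using N False by (simp add: n_def card_gt_0_iff)
  let ?c = "\<lambda>S. fact (card S - 1) * fact (n - card S) / fact n * v S"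
  let ?d = "\<lambda>S. fact (card S - 1) * fact (n - 1 - card S) / fact (n - 1) * v S"
  have "(\<Sum>i\<in>N. potential v (N - {i})) = (\<Sum>i\<in>N. \<Sum>S\<in>{S \<in> Pow N. i \<notin> S}. ?d S)"
    unfolding potential_def by (intro sum.cong) (auto simp: n_def)
  also have "\<dots> = (\<Sum>S\<in>Pow N. \<Sum>i\<in>{i \<in> N. i \<notin> S}. ?d S)"
    using N by (intro sum.swap_restrict) auto
  also have "\<dots> = (\<Sum>S\<in>Pow N. real (n - card S) * ?d S)"
  proof (intro sum.cong refl)
    fix S assume "S \<in> Pow N"
    then have "card {i \<in> N. i \<notin> S} = n - card S"
      using N by (metis PowD card_Diff_subset finite_subset n_def set_diff_eq)
    then show "(\<Sum>i\<in>{i \<in> N. i \<notin> S}. ?d S) = real (n - card S) * ?d S"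
      by simp
  qed
  \<comment> \<open>The term for \<open>N\<close> has factor 0. It is split off first because
    \<open>n - 1 - card S\<close> is truncated there and the factorial identity would fail.\<close>
  also have "\<dots> = (\<Sum>S\<in>Pow N - {N}. real (n - card S) * ?d S)"
    using N by (simp add: sum.remove[of "Pow N" N] n_def)
  also have "\<dots> = (\<Sum>S\<in>Pow N - {N}. real n * ?c S)"
  proof (intro sum.cong refl)
    fix S assume "S \<in> Pow N - {N}"
    then have "card S < n"
      using N by (auto simp: n_def intro!: psubset_card_mono)
    then obtain d where d: "n = Suc (card S + d)"
      using less_imp_Suc_add by blast
    show "real (n - card S) * ?d S = real n * ?c S"
      unfolding d by (simp add: Suc_diff_le divide_simps)
  qed
  finally have "(\<Sum>i\<in>N. potential v (N - {i})) = real n * (\<Sum>S\<in>Pow N - {N}. ?c S)"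
    by (simp add: sum_distrib_left)
  moreover have "potential v N = ?c N + (\<Sum>S\<in>Pow N - {N}. ?c S)"
    using N by (simp add: potential_def sum.remove[of "Pow N" N] n_def)
  moreover have "real n * ?c N = v N"
    using n by (simp add: n_def[symmetric] fact_reduce[of n])
  ultimately show ?thesis
    by (simp add: sum_subtractf n_def distrib_left)
qed (simp add: v)

text \<open>Efficiency on a nonempty \<open>N\<close> expresses \<open>Q N\<close> through the
  values \<open>Q (N - {i})\<close>, so it determines \<open>Q\<close> recursively from
  \<open>Q {} = 0\<close>.\<close>

lemma potential_unique:
  assumes "finite N" and "v {} = 0" and "Q {} = 0"
    and "\<And>S. S \<subseteq> N \<Longrightarrow> (\<Sum>i\<in>S. Q S - Q (S - {i})) = v S"
  shows "Q N = potential v N"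
  using assms(1,4)
proof (induction N rule: finite_psubset_induct)
  case (psubset N)
  show ?case
  proof (cases "N = {}")
    case False
    have "Q (N - {i}) = potential v (N - {i})" if "i \<in> N" for i
      using that psubset.prems by (intro psubset.IH) auto
    then have "(\<Sum>i\<in>N. Q N - Q (N - {i})) = (\<Sum>i\<in>N. Q N - potential v (N - {i}))"
      by simp
    then have "(\<Sum>i\<in>N. Q N - potential v (N - {i})) = (\<Sum>i\<in>N. potential v N - potential v (N - {i}))"
      using psubset.prems[of N] sum_potential_diff[OF psubset.hyps, of v] assms(2) by simp
    then show ?thesis
      using False psubset.hyps by (simp add: sum_subtractf)
  qed (simp add: assms potential_def)
qed

text \<open>By efficiency on \<open>insert j S\<close>, taking away the payoff of \<open>j\<close>
  leaves the sum of the marginal potentials of the members of \<open>S\<close>. This is the defining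
  recursion of the potential of \<open>u\<close>.\<close>

lemma shapley_hm_consistent:
  assumes N: "finite N" and ij: "i \<in> N" "j \<in> N" "i \<noteq> j" and v: "v {} = 0" and u: "u {} = 0"
    and red: "\<And>S. S \<subseteq> N - {j} \<Longrightarrow> S \<noteq> {} \<Longrightarrow> u S = v (insert j S) - shapley (insert j S) v j"
  shows "shapley (N - {j}) u i = shapley N v i"
proof -
  let ?P = "potential v"
  \<comment> \<open>The constant normalises \<open>Q {}\<close> to 0, as
    \<open>potential_unique\<close> demands, and cancels in all differences.\<close>
  define Q where "Q S = ?P (insert j S) - ?P {j}" for S
  have sum_Q: "(\<Sum>i\<in>S. Q S - Q (S - {i})) = u S" if S: "S \<subseteq> N - {j}" for S
  proof (cases "S = {}")
    case False
    have fin: "finite S" and j: "j \<notin> S"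
      using S N finite_subset by auto
    have "(\<Sum>i\<in>S. Q S - Q (S - {i})) = (\<Sum>i\<in>S. ?P (insert j S) - ?P (insert j S - {i}))"
      using j by (intro sum.cong) (auto simp: Q_def insert_Diff_if)
    also have "\<dots> = v (insert j S) - (?P (insert j S) - ?P (insert j S - {j}))"
      using sum_potential_diff[of "insert j S" v] fin j v by simp
    also have "\<dots> = u S"
      using red[OF S False] shapley_eq_potential_diff[of "insert j S" j v] fin v by simp
    finally show ?thesis .
  qed (simp add: u)
  have Q: "Q T = potential u T" if "T \<subseteq> N - {j}" for T
    using that N u sum_Q by (intro potential_unique) (auto simp: Q_def finite_subset)
  have "shapley (N - {j}) u i = Q (N - {j}) - Q (N - {j} - {i})"
    using shapley_eq_potential_diff[of "N - {j}" i u] N ij u by (simp add: Q)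
  also have "\<dots> = ?P N - ?P (N - {i})"
  proof -
    have "insert j (N - {j} - {i}) = N - {i}"
      using ij by auto
    then show ?thesis
      using ij by (simp add: Q_def insert_absorb)
  qed
  also have "\<dots> = shapley N v i"
    using shapley_eq_potential_diff[of N i v] N ij v by simp
  finally show ?thesis .
qed

section \<open>The two axioms for MPW\<close>

lemma MPW_apply: "N \<subseteq> U \<Longrightarrow> w \<in> tux_games N \<Longrightarrow> MPW U N w = shapley N (average_game N w)"
  by (simp add: MPW_def)

lemma MPW_in_solutions: "MPW U \<in> solutions U"
  by (auto simp: solutions_def MPW_def shapley_def)

lemma MPW_two_standard: "two_standard U (MPW U)"
  unfolding two_standard_def
proof (intro ballI impI)
  fix i j w assume U: "i \<in> U" "j \<in> U" "i \<noteq> j" and w: "w \<in> tux_games {i, j}"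
  have d: "{i, j} - {i} = {j}" "{i, j} - {j} = {i}"
    using U by auto
  have "average_game {i, j} w {i} = w ({i}, {{j}})" "average_game {i, j} w {j} = w ({j}, {{i}})"
    "average_game {i, j} w {i, j} = w ({i, j}, {})"
    using U by (auto simp: average_game_def d)
  moreover have "Pow {j} = {{}, {j}}" "{j, i} = {i, j}"
    by auto
  ultimately have "shapley {i, j} (average_game {i, j} w) i =
      w ({i}, {{j}}) + (w ({i, j}, {}) - w ({j}, {{i}}) - w ({i}, {{j}})) / 2"
    using U by (simp add: shapley_def d average_game_empty[OF w] field_simps)
  then show "MPW U {i, j} w i = w ({i}, {{j}}) + (w ({i, j}, {}) - w ({j}, {{i}}) - w ({i}, {{j}})) / 2"
    using U w by (simp add: MPW_apply)
qed

section \<open>The Hart--Mas-Colell reduced game and its average game\<close>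

lemma hm_reduced_game_tux_games: "hm_reduced_game \<phi> N w j \<in> tux_games (N - {j})"
  by (auto simp: tux_games_def hm_reduced_game_def embedded_coalitions_def)

text \<open>The set of outsiders is the same on both sides, and the payoff subtracted does not
  depend on their partition, so \<open>sum_weight\<close> lets it pass through the average
  unchanged. The solution \<phi> is arbitrary, which serves both the axiom for MPW and
  uniqueness.\<close>

lemma average_game_hm_reduced_game:
  assumes N: "finite N" "j \<in> N" and S: "S \<subseteq> N - {j}" "S \<noteq> {}"
  shows "average_game (N - {j}) (hm_reduced_game \<phi> N w j) S =
    average_game N w (insert j S) - \<phi> (insert j S) (remove_players N w (N - insert j S)) j"
proof -
  define M where "M = N - insert j S"
  let ?p = "\<phi> (insert j S) (remove_players N w M) j"
  have M: "finite M" "N - {j} - S = M"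
    using N by (auto simp: M_def)
  have fS: "finite S" "j \<notin> S"
    using S N finite_subset by auto
  have card: "card (N - {j}) - card S = card M" "card N - card (insert j S) = card M"
  proof -
    show "card (N - {j}) - card S = card M"
      unfolding M(2)[symmetric] using fS S by (intro card_Diff_subset[symmetric])
    show "card N - card (insert j S) = card M"
      unfolding M_def using fS S N by (intro card_Diff_subset[symmetric]) auto
  qed
  have "(\<Sum>\<pi>\<in>partitions M. weight \<pi> * hm_reduced_game \<phi> N w j (S, \<pi>)) =
      (\<Sum>\<pi>\<in>partitions M. weight \<pi> * w (insert j S, \<pi>) - weight \<pi> * ?p)"
    using S M by (intro sum.cong refl)
      (auto simp: hm_reduced_game_def embedded_coalitions_def right_diff_distrib simp flip: M_def)
  also have "\<dots> = (\<Sum>\<pi>\<in>partitions M. weight \<pi> * w (insert j S, \<pi>)) - fact (card M) * ?p"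
    by (simp add: sum_subtractf sum_weight[OF M(1)] flip: sum_distrib_right)
  finally have "average_game (N - {j}) (hm_reduced_game \<phi> N w j) S =
      ((\<Sum>\<pi>\<in>partitions M. weight \<pi> * w (insert j S, \<pi>)) - fact (card M) * ?p) / fact (card M)"
    using S(1) by (simp add: average_game_weight M(2) card(1))
  moreover have "average_game N w (insert j S) =
      (\<Sum>\<pi>\<in>partitions M. weight \<pi> * w (insert j S, \<pi>)) / fact (card M)"
    using average_game_weight[of "insert j S" N w] subset_trans[OF S(1) Diff_subset] N card(2)
    by (simp flip: M_def del: card_insert_disjoint)
  ultimately show ?thesis
    by (simp add: diff_divide_distrib flip: M_def)
qed

lemma MPW_hm_consistent:
  assumes "finite U"
  shows "hm_consistent U (MPW U)"
  unfolding hm_consistent_def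
proof (intro ballI impI)
  fix N w i j
  assume NU: "N \<in> Pow U" and w: "w \<in> tux_games N" and ij: "i \<in> N" "j \<in> N" "i \<noteq> j"
  have N: "finite N"
    using NU assms finite_subset by auto
  let ?r = "hm_reduced_game (MPW U) N w j"
  let ?v = "average_game N w"
  \<comment> \<open>Averaging commutes with reduction: removing players restricts the average game,
    so the payoff subtracted is the Shapley value of \<open>j\<close> in the restricted TU
    game.\<close>
  have "average_game (N - {j}) ?r S = ?v (insert j S) - shapley (insert j S) ?v j"
    if S: "S \<subseteq> N - {j}" "S \<noteq> {}" for S
  proof -
    let ?T = "N - insert j S"
    have T: "finite ?T" "?T \<subseteq> N" "N - ?T = insert j S"
      using N S ij by auto
    have g: "remove_players N w ?T \<in> tux_games (insert j S)"
      using remove_players_tux_games[OF T(1,2) w] T(3) by simp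
    have "insert j S \<subseteq> U"
      using NU S ij by auto
    then have "MPW U (insert j S) (remove_players N w ?T) =
        shapley (insert j S) (average_game (insert j S) (remove_players N w ?T))"
      using g by (rule MPW_apply)
    also have "\<dots> = shapley (insert j S) ?v"
      using average_game_remove_players[OF N T(2)] by (intro shapley_cong) (simp add: T(3))
    finally show ?thesis
      using average_game_hm_reduced_game[OF N ij(2) S] by simp
  qed
  then have "shapley (N - {j}) (average_game (N - {j}) ?r) i = shapley N ?v i"
    using N ij average_game_empty[OF w] average_game_empty[OF hm_reduced_game_tux_games]
    by (intro shapley_hm_consistent) auto
  moreover have "N - {j} \<subseteq> U" "N \<subseteq> U"
    using NU by auto
  ultimately show "MPW U N w i = MPW U (N - {j}) ?r i"
    using w by (simp add: MPW_apply hm_reduced_game_tux_games)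
qed

section \<open>Uniqueness\<close>

lemma solutions_eqI:
  assumes "\<phi> \<in> solutions U" "\<psi> \<in> solutions U" "N \<subseteq> U"
    and "\<And>w i. w \<in> tux_games N \<Longrightarrow> i \<in> N \<Longrightarrow> \<phi> N w i = \<psi> N w i"
  shows "\<phi> N = \<psi> N"
proof -
  have mem: "\<phi> N \<in> tux_games N \<rightarrow>\<^sub>E (N \<rightarrow>\<^sub>E UNIV)" "\<psi> N \<in> tux_games N \<rightarrow>\<^sub>E (N \<rightarrow>\<^sub>E UNIV)"
    using PiE_mem[OF assms(1)[unfolded solutions_def], of N]
      PiE_mem[OF assms(2)[unfolded solutions_def], of N] assms(3) by simp_all
  show ?thesis
  proof (rule PiE_ext[OF mem])
    show "\<phi> N w = \<psi> N w" if w: "w \<in> tux_games N" for w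
      using PiE_mem[OF mem(1) w] PiE_mem[OF mem(2) w] assms(4)[OF w] by (rule PiE_ext)
  qed
qed

lemma one_player_value:
  assumes std: "two_standard U \<phi>" and con: "hm_consistent U \<phi>"
    and ij: "i \<in> U" "j \<in> U" "i \<noteq> j" and w: "w \<in> tux_games {i}"
  shows "\<phi> {i} w i = w ({i}, {})"
proof -
  define c where "c = w ({i}, {})"
  \<comment> \<open>\<open>j\<close> is added as a null player. Two-standardness pays c to
    \<open>i\<close> and 0 to \<open>j\<close>, so removing \<open>j\<close> from \<open>u\<close>
    by reduction gives back \<open>w\<close>.\<close>
  define u where "u = (\<lambda>(S, \<pi>)\<in>embedded_coalitions {i, j}. if i \<in> S then c else 0)"
  have u: "u \<in> tux_games {i, j}"
    by (auto simp: u_def tux_games_def embedded_coalitions_def)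
  have d: "{i, j} - {i} = {j}" "{i, j} - {j} = {i}"
    using ij by auto
  have vals: "u ({i}, {{j}}) = c" "u ({j}, {{i}}) = 0" "u ({i, j}, {}) = c"
    using ij by (auto simp: u_def embedded_coalitions_def d)
  have u': "u \<in> tux_games {j, i}"
    using u by (simp add: insert_commute)
  have \<phi>_i: "\<phi> {i, j} u i = c"
    using std ij u vals unfolding two_standard_def by auto
  have \<phi>_j: "\<phi> {i, j} u j = 0"
  proof -
    have "\<phi> {j, i} u j = u ({j}, {{i}}) + (u ({j, i}, {}) - u ({i}, {{j}}) - u ({j}, {{i}})) / 2"
      using std[unfolded two_standard_def, rule_format, of j i u] ij u' by simp
    then show ?thesis
      using vals by (simp add: insert_commute)
  qed
  have "hm_reduced_game \<phi> {i, j} u j \<in> tux_games {i}"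
    using hm_reduced_game_tux_games[of \<phi> "{i, j}" u j] d by simp
  moreover have "hm_reduced_game \<phi> {i, j} u j ({i}, {}) = c"
    using vals \<phi>_j by (simp add: hm_reduced_game_def d embedded_coalitions_def insert_commute)
  moreover have "g = w" if "g \<in> tux_games {i}" "g ({i}, {}) = c" for g
  proof (rule PiE_ext)
    show "g \<in> embedded_coalitions {i} \<rightarrow>\<^sub>E UNIV" "w \<in> embedded_coalitions {i} \<rightarrow>\<^sub>E UNIV"
      using that w by (simp_all add: tux_games_def)
    fix x assume "x \<in> embedded_coalitions {i}"
    then consider "x = ({i}, {})" | "x = ({}, {{i}})"
      by (auto simp: embedded_coalitions_def dest: subset_singletonD)
    then show "g x = w x"
      by cases (use that w in \<open>simp_all add: tux_games_def c_def\<close>)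
  qed
  ultimately have "hm_reduced_game \<phi> {i, j} u j = w"
    by blast
  moreover have "\<phi> {i, j} u i = \<phi> ({i, j} - {j}) (hm_reduced_game \<phi> {i, j} u j) i"
    using con ij u unfolding hm_consistent_def by blast
  ultimately show ?thesis
    using \<phi>_i d by (simp add: c_def)
qed

text \<open>The grand coalition enters the payoff of \<open>i\<close> only through
  \<open>S = N - {i}\<close>, whose coefficient is (n-1)! 0! / n! = 1/n.\<close>

lemma shapley_change_grand:
  assumes "finite N" and i: "i \<in> N" and eq: "\<And>S. S \<subset> N \<Longrightarrow> v S = v' S"
  shows "shapley N v i - shapley N v' i = (v N - v' N) / real (card N)"
proof -
  let ?k = "\<lambda>S. fact (card S) * fact (card N - card S - 1) / fact (card N) :: real"
  have "shapley N v i - shapley N v' i =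
      (\<Sum>S\<in>Pow (N - {i}). ?k S * (v (S \<union> {i}) - v' (S \<union> {i})))"
  proof -
    have "?k S * (v (S \<union> {i}) - v S) - ?k S * (v' (S \<union> {i}) - v' S) =
        ?k S * (v (S \<union> {i}) - v' (S \<union> {i}))" if "S \<in> Pow (N - {i})" for S
    proof -
      have "v S = v' S"
        using that i by (intro eq) auto
      then show ?thesis
        by (simp add: right_diff_distrib)
    qed
    then show ?thesis
      unfolding shapley_def using i
      by (simp only: restrict_apply if_True flip: sum_subtractf) (rule sum.cong[OF refl])
  qed
  also have "\<dots> = (\<Sum>S\<in>{N - {i}}. ?k S * (v (S \<union> {i}) - v' (S \<union> {i})))"
  proof (rule sum.mono_neutral_right)
    show "\<forall>S\<in>Pow (N - {i}) - {N - {i}}. ?k S * (v (S \<union> {i}) - v' (S \<union> {i})) = 0"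
    proof
      fix S assume "S \<in> Pow (N - {i}) - {N - {i}}"
      then have "S \<union> {i} \<subset> N"
        using i by auto
      then show "?k S * (v (S \<union> {i}) - v' (S \<union> {i})) = 0"
        using eq by simp
    qed
  qed (use assms in auto)
  also have "\<dots> = (v N - v' N) / real (card N)"
  proof -
    obtain m where m: "card N = Suc m"
      using assms by (metis card_Suc_Diff1)
    then show ?thesis
      using assms by (simp add: insert_absorb divide_simps)
  qed
  finally show ?thesis .
qed

text \<open>The induction compares \<open>\<phi> N\<close> and \<open>MPW U N\<close> as functions
  of the game, so its hypothesis applies to whatever game the reduction yields on a smaller player
  set. For the empty player set, extensionality alone suffices.\<close>

lemma hm_solution_eq_MPW:
  assumes U: "finite U" "card U \<noteq> 1" and \<phi>: "\<phi> \<in> solutions U"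
    and std: "two_standard U \<phi>" and con: "hm_consistent U \<phi>" and "N \<subseteq> U"
  shows "\<phi> N = MPW U N"
proof -
  have "finite N"
    using U \<open>N \<subseteq> U\<close> finite_subset by auto
  then show ?thesis
    using \<open>N \<subseteq> U\<close>
  proof (induction N rule: finite_psubset_induct)
    case (psubset N)
    have mstd: "two_standard U (MPW U)" and mcon: "hm_consistent U (MPW U)"
      using MPW_two_standard MPW_hm_consistent[OF U(1)] by auto
    show ?case
    proof (rule solutions_eqI[OF \<phi> MPW_in_solutions psubset.prems])
      fix w i assume w: "w \<in> tux_games N" and i: "i \<in> N"
      define n where "n = card N"
      have "n > 0"
        using i psubset.hyps by (auto simp: n_def card_gt_0_iff)
      then consider "n = 1" | "n = 2" | "n \<ge> 3"
        by linarith
      then show "\<phi> N w i = MPW U N w i"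
      proof cases
        case 1
        then have N: "N = {i}"
          using i by (auto simp: n_def card_1_singleton_iff)
        \<comment> \<open>A second player is needed to realise the one-player game as a reduced
          game.\<close>
        have "U \<noteq> {i}"
          using U(2) by auto
        then obtain j where "j \<in> U" "i \<noteq> j"
          using i psubset.prems by auto
        then show ?thesis
          using one_player_value[OF std con, of i j w] one_player_value[OF mstd mcon, of i j w]
            w i psubset.prems unfolding N by auto
      next
        case 2
        then obtain j where "N = {i, j}" "i \<noteq> j"
          using i by (auto simp: n_def card_2_iff)
        then show ?thesis
          using std mstd w psubset.prems unfolding two_standard_def by auto
      next
        case 3
        define x where "x k = \<phi> N w k - MPW U N w k" for k
        have step: "x k = - x l / (real n - 1)" if kl: "k \<in> N" "l \<in> N" "k \<noteq> l" for k l
        proof -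
          let ?M = "N - {l}"
          let ?r = "hm_reduced_game \<phi> N w l" and ?s = "hm_reduced_game (MPW U) N w l"
          have NU: "?M \<subseteq> U" and lM: "insert l ?M = N" "?M \<noteq> {}"
            using psubset.prems kl by auto
          have IH: "\<phi> ?M = MPW U ?M"
            using kl NU by (intro psubset.IH) auto
          have "\<phi> N w k = shapley ?M (average_game ?M ?r) k"
          proof -
            have "\<phi> N w k = \<phi> ?M ?r k"
              using con psubset.prems w kl unfolding hm_consistent_def by blast
            then show ?thesis
              by (simp add: IH MPW_apply[OF NU hm_reduced_game_tux_games])
          qed
          moreover have "MPW U N w k = shapley ?M (average_game ?M ?s) k"
          proof -
            have "MPW U N w k = MPW U ?M ?s k"
              using mcon psubset.prems w kl unfolding hm_consistent_def by blast
            then show ?thesis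
              by (simp add: MPW_apply[OF NU hm_reduced_game_tux_games])
          qed
          \<comment> \<open>For a proper subset \<open>S\<close> of \<open>?M\<close>, the payoff
            subtracted is computed on \<open>insert l S\<close>, still smaller than
            \<open>N\<close>, so the induction hypothesis equates both versions.\<close>
          moreover have "average_game ?M ?r S = average_game ?M ?s S" if "S \<subset> ?M" for S
          proof (cases "S = {}")
            case True
            then show ?thesis
              by (simp add: average_game_empty hm_reduced_game_tux_games)
          next
            case False
            have "insert l S \<subset> N"
              using that kl by auto
            then have "\<phi> (insert l S) = MPW U (insert l S)"
              using psubset.prems by (intro psubset.IH) auto
            then show ?thesis
              using that False average_game_hm_reduced_game[OF psubset.hyps kl(2), of S] by auto
          qed
          ultimately have "x k = (average_game ?M ?r ?M - average_game ?M ?s ?M) / real (card ?M)"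
            using shapley_change_grand[of ?M k "average_game ?M ?r" "average_game ?M ?s"]
              psubset.hyps kl by (simp add: x_def)
          \<comment> \<open>At \<open>?M\<close> itself nobody is removed: the payoffs subtracted
            are those of \<open>l\<close> in \<open>w\<close>, and they differ by the error
            \<open>x l\<close>.\<close>
          also have "average_game ?M ?r ?M - average_game ?M ?s ?M = - x l"
            using average_game_hm_reduced_game[OF psubset.hyps kl(2), of ?M] lM
            by (simp add: x_def)
          also have "real (card ?M) = real n - 1"
            using psubset.hyps kl 3 by (simp add: n_def of_nat_diff)
          finally show ?thesis .
        qed
        have "N \<noteq> {i}"
          using 3 by (auto simp: n_def)
        then obtain j where j: "j \<in> N" "i \<noteq> j"
          using i by auto
        have m: "real n - 1 \<ge> 2"
          using 3 by simp
        have e: "x i * (real n - 1) = - x j" "x j * (real n - 1) = - x i"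
        proof -
          show "x i * (real n - 1) = - x j"
            using step[OF i j] m by simp
          show "x j * (real n - 1) = - x i"
            using step[OF j(1) i j(2)[symmetric]] m by simp
        qed
        have "x i * ((real n - 1) * (real n - 1) - 1) = x i * (real n - 1) * (real n - 1) - x i"
          by algebra
        also have "\<dots> = 0"
          unfolding e(1) using e(2) by simp
        finally have "x i * ((real n - 1) * (real n - 1) - 1) = 0" .
        \<comment> \<open>This makes the factor of \<open>x i\<close> nonzero. For n = 2 it would be
          0, which is why two-player games are settled by two-standardness.\<close>
        moreover have "(real n - 1) * (real n - 1) \<ge> 2 * 2"
          using m by (intro mult_mono) auto
        ultimately have "x i = 0"
          by auto
        then show ?thesis
          by (simp add: x_def)
      qed
    qed
  qed
qed

text \<open>If \<open>U\<close> had exactly one player, both axioms would hold vacuously for every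
  solution and leave one-player games undetermined; hence the assumption on
  \<open>card U\<close>.\<close>

theorem theorem9:
  fixes U :: "'a set"
  assumes "finite U" and "card U \<noteq> 1"
  shows "MPW U \<in> solutions U \<and> two_standard U (MPW U) \<and> hm_consistent U (MPW U) \<and>
    (\<forall>\<phi>\<in>solutions U. two_standard U \<phi> \<and> hm_consistent U \<phi> \<longrightarrow> \<phi> = MPW U)"
proof (intro conjI ballI impI)
  fix \<phi> assume \<phi>: "\<phi> \<in> solutions U" "two_standard U \<phi> \<and> hm_consistent U \<phi>"
  show "\<phi> = MPW U"
  proof (rule PiE_ext[of _ "Pow U"])
    show "\<phi> \<in> (\<Pi>\<^sub>E N\<in>Pow U. tux_games N \<rightarrow>\<^sub>E (N \<rightarrow>\<^sub>E UNIV))"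
      using \<phi> by (simp add: solutions_def)
    show "MPW U \<in> (\<Pi>\<^sub>E N\<in>Pow U. tux_games N \<rightarrow>\<^sub>E (N \<rightarrow>\<^sub>E UNIV))"
      using MPW_in_solutions[of U] by (simp add: solutions_def)
  qed (use hm_solution_eq_MPW[OF assms] \<phi> in auto)
qed (use MPW_in_solutions MPW_two_standard MPW_hm_consistent[OF assms(1)] in auto)

end
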